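(* Let $a\in(4/15,\infty)$ and $a_1=\frac{40+3\sqrt{205}}{105}\approx 0.79003$. Then the inequality $$\psi(x+1)<\mathcal{L}(x,a)$$ holds for all $x\in(-1,\infty)$ if and only if $a\ge a_1$. Moreover, if $a\ge a_1$, then for all $x>0$ $$\mathcal{L}(x,a)-c_0(a)<\psi(x+1)<\mathcal{L}(x,a),$$ where $$c_0(a)=\mathcal{L}(0,a)+\gamma=\frac{1}{90a^2+2}\ln\frac{3a+1}{3}+\frac{45a^2}{90a^2+2}\ln\frac{15a-1}{45a}+\gamma$$ is the best constant (i.e. $c_0(a)$ cannot be replaced by any smaller constant in the left-hand inequality), and, for each fixed $x>0$, the lower bound $\mathcal{L}(x,a)-c_0(a)$ and the upper bound $\mathcal{L}(x,a)$ are respectively decreasing and increasing in $a$ on $(a_1,\infty)$.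
   Context: $\psi(x)=\Gamma'(x)/\Gamma(x)$ ($x>0$) is the digamma (psi) function and $\gamma=0.5772\ldots$ is the Euler–Mascheroni constant. For $x>-1$ and $a>4/15$, $$\mathcal{L}(x,a)=\frac{1}{90a^{2}+2}\ln\left(x^{2}+x+\frac{3a+1}{3}\right)+\frac{45a^{2}}{90a^{2}+2}\ln\left(x^{2}+x+\frac{15a-1}{45a}\right).$$ *)

theory Defs
  imports "HOL-Analysis.Analysis"
begin

text \<open>
  The psi function is the library's \<^const>\<open>Polygamma\<close> \<open>0\<close>, i.e. \<open>Digamma\<close>, which the library
  defines by a series; on the positive reals it is the logarithmic derivative of \<open>Gamma\<close>:
\<close>

lemma Digamma_eq_log_deriv_Gamma:
  fixes x :: real
  assumes "x > 0"
  shows "Digamma x = deriv Gamma x / Gamma x"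
proof -
  have "x \<notin> \<int>\<^sub>\<le>\<^sub>0"
    using assms by (auto elim!: nonpos_Ints_cases)
  then have "(Gamma has_field_derivative Gamma x * Digamma x) (at x)"
    by (rule has_field_derivative_Gamma)
  then have "deriv Gamma x = Gamma x * Digamma x"
    by (rule DERIV_imp_deriv)
  moreover have "Gamma x \<noteq> 0"
    using Gamma_real_pos[OF assms] by simp
  ultimately show ?thesis
    by simp
qed

text \<open>For \<open>a > 4/15\<close> both arguments of \<^const>\<open>ln\<close> below are positive for every real \<open>x\<close>.\<close>

definition psi_L :: "real \<Rightarrow> real \<Rightarrow> real" where
  "psi_L x a =
     1 / (90 * a^2 + 2) * ln (x^2 + x + (3 * a + 1) / 3)
     + 45 * a^2 / (90 * a^2 + 2) * ln (x^2 + x + (15 * a - 1) / (45 * a))"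

definition a1 :: real where
  "a1 = (40 + 3 * sqrt 205) / 105"

definition c0 :: "real \<Rightarrow> real" where
  "c0 a = psi_L 0 a + euler_mascheroni"

end

theory Submission
  imports Defs "HOL-Real_Asymp.Real_Asymp"
begin

text \<open>
  Put \<open>z = x\<^sup>2 + x + 1/3\<close> and \<open>q = 1/(45 a)\<close>. The two arguments of the logarithm in \<open>psi_L x a\<close>
  are \<open>z + a\<close> and \<open>z - q\<close>, and the weights are \<open>q / (2 (a + q))\<close> and \<open>a / (2 (a + q))\<close>. Since
  \<open>a q = 1/45\<close> is constant, the derivative of \<open>psi_L x a\<close> in \<open>x\<close> depends on \<open>a\<close> only through the
  sum of the shifts \<open>m = a - q\<close>: it is \<open>(x + 1/2) (z + m) / (z\<^sup>2 + m z - 1/45)\<close>. As \<open>a > 0\<close> grows,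
  so does \<open>m\<close>, and \<open>a = a1\<close> corresponds to \<open>m = 16/21\<close>.

  The psi function enters only through \<open>Digamma (s + 1) - Digamma s = 1 / s\<close> and its logarithmic
  growth. The difference \<open>F x = psi_L x a - Digamma (x + 1)\<close> (\<open>psi_gap\<close>) tends to \<open>0\<close> along
  \<open>x, x + 1, x + 2, ...\<close>, and its increment \<open>F s - F (s - 1)\<close> (\<open>psi_step\<close>) is an elementary
  function of \<open>s\<close> that tends to \<open>0\<close> likewise. The derivative of the increment is a rational function.
  The parameters in \<open>psi_L\<close> are such that almost everything cancels in its numerator:
  over a positive denominator there remains
  \<open>7/45 (m - 16/21) s\<^sup>2 + (m/3 + 4/45)\<^sup>2\<close> (lemma \<open>psi_step_deriv_eq\<close>).

  If \<open>a \<ge> a1\<close>, this is positive for all \<open>s > 0\<close>. So the increment increases strictly to \<open>0\<close> and is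
  therefore negative; hence \<open>F\<close> decreases along unit steps to \<open>0\<close> and is positive. For \<open>x < y\<close> the
  difference \<open>F x - F y\<close> also decreases along unit steps to \<open>0\<close>, because its increments are differences
  of increments; so \<open>F\<close> is strictly decreasing. For \<open>x > 0\<close> this gives \<open>0 < F x < F 0 = c0 a\<close>, and
  continuity at \<open>0\<close> makes \<open>c0 a\<close> best possible. If \<open>a < a1\<close>, the numerator is eventually
  negative, all signs reverse for large arguments, and \<open>F\<close> becomes negative.

  For the dependence on \<open>a\<close>, the derivative in \<open>x\<close> decreases strictly with \<open>m\<close>. So for \<open>a < b\<close> the function
  \<open>psi_L x b - psi_L x a\<close> is strictly decreasing in \<open>x > -1/2\<close>, and it tends to \<open>0\<close>. It is therefore
  positive, and for \<open>x > 0\<close> it is below its value at \<open>0\<close>; these are the two monotonicity claims.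
\<close>

section \<open>Slope, increment and gap\<close>

definition shift_sum :: "real \<Rightarrow> real" where
  "shift_sum a = a - 1 / (45 * a)"

text \<open>
  The derivative of \<open>psi_L x a\<close> in \<open>x\<close>, for \<open>m = shift_sum a\<close>.
\<close>
definition psi_slope :: "real \<Rightarrow> real \<Rightarrow> real" where
  "psi_slope m x = (x + 1/2) * (x^2 + x + 1/3 + m) /
     ((x^2 + x + 1/3)^2 + m * (x^2 + x + 1/3) - 1/45)"

text \<open>
  The increment of \<open>psi_gap\<close> from \<open>s - 1\<close> to \<open>s\<close>, in a form from which the psi function has been
  eliminated by its recurrence.
\<close>
definition psi_step :: "real \<Rightarrow> real \<Rightarrow> real" where
  "psi_step a s = psi_L s a - psi_L (s - 1) a - 1 / s"

definition psi_gap :: "real \<Rightarrow> real \<Rightarrow> real" where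
  "psi_gap a x = psi_L x a - Digamma (x + 1)"

section \<open>Strict sign from a monotone limit\<close>

lemma limit_less_of_strictly_decreasing:
  fixes u :: "nat \<Rightarrow> real"
  assumes lim: "u \<longlonglongrightarrow> l" and dec: "\<And>n. u (Suc n) < u n"
  shows "l < u 0"
proof -
  have "decseq u"
    using dec by (intro decseq_SucI) (simp add: less_imp_le)
  then have "l \<le> u (Suc 0)"
    using lim by (rule decseq_ge)
  then show ?thesis
    using dec[of 0] by simp
qed

lemma less_limit_of_strictly_increasing:
  fixes u :: "nat \<Rightarrow> real"
  assumes lim: "u \<longlonglongrightarrow> l" and inc: "\<And>n. u n < u (Suc n)"
  shows "u 0 < l"
  using limit_less_of_strictly_decreasing[OF tendsto_minus[OF lim]] inc by simp

section \<open>The parameter and the positivity of the denominators\<close>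

lemma shift_sum_less_iff:
  assumes "a > 0" "b > 0"
  shows "shift_sum a < shift_sum b \<longleftrightarrow> a < b"
proof -
  have mono: "shift_sum c < shift_sum d" if "0 < c" "c < d" for c d
    using that frac_less2[of 1 1 "45 * c" "45 * d"] by (simp add: shift_sum_def)
  show ?thesis
    using mono[of a b] mono[of b a] assms by (cases a b rule: linorder_cases) auto
qed

text \<open>
  \<open>a1\<close> is the positive root of \<open>45 a\<^sup>2 - (240/7) a - 1 = 0\<close>, which is \<open>a - 1/(45 a) = 16/21\<close> with
  the denominator cleared.
\<close>
lemma a1_le_iff:
  assumes "a > 0"
  shows "a1 \<le> a \<longleftrightarrow> 16 / 21 \<le> shift_sum a"
proof -
  have pos: "a1 > 0"
    by (simp add: a1_def add_pos_nonneg)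
  have "sqrt 205 * sqrt 205 = (205::real)"
    by simp
  then have "45 * a1 * a1 - 1 = 16 / 21 * (45 * a1)"
    unfolding a1_def by (simp add: field_simps)
  then have "shift_sum a1 = 16 / 21"
    using pos unfolding shift_sum_def by (simp add: field_simps)
  then show ?thesis
    using shift_sum_less_iff[OF assms pos] by linarith
qed

lemma quadratic_ge: "x^2 + x + 1/3 \<ge> (1/12 :: real)"
proof -
  have "x^2 + x + 1/3 = (x + 1/2)^2 + (1/12 :: real)"
    by (simp add: power2_eq_square algebra_simps)
  then show ?thesis by simp
qed

text \<open>
  The quadratic \<open>x\<^sup>2 + x + 1/3\<close> has minimum \<open>1/12\<close>, and \<open>a > 4/15\<close> is exactly \<open>1/(45 a) < 1/12\<close>.
\<close>
lemma
  fixes a x :: real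
  assumes "a > 4/15"
  shows ln_arg1_pos: "x^2 + x + 1/3 + a > 0"
    and ln_arg2_pos: "x^2 + x + 1/3 - 1 / (45 * a) > 0"
proof -
  have "1 / (45 * a) < 1 / 12"
    using assms by (simp add: field_simps)
  then show "x^2 + x + 1/3 - 1 / (45 * a) > 0"
    using quadratic_ge[of x] by linarith
  show "x^2 + x + 1/3 + a > 0"
    using assms quadratic_ge[of x] by linarith
qed

lemma slope_denominator_pos:
  assumes "a > 4/15"
  shows "(x^2 + x + 1/3)^2 + shift_sum a * (x^2 + x + 1/3) - 1/45 > 0"
proof -
  define z where "z = x^2 + x + 1/3"
  have "z^2 + shift_sum a * z - 1/45 = (z + a) * (z - 1 / (45 * a))"
    using assms by (simp add: shift_sum_def field_simps power2_eq_square)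
  also have "\<dots> > 0"
    using ln_arg1_pos[OF assms, of x] ln_arg2_pos[OF assms, of x] by (simp add: z_def)
  finally show ?thesis by (simp add: z_def)
qed

section \<open>Derivatives of the approximation and of its increment\<close>

lemma psi_L_eq:
  assumes "a > 4/15"
  shows "psi_L x a = 1 / (90 * a^2 + 2) * ln (x^2 + x + 1/3 + a)
           + 45 * a^2 / (90 * a^2 + 2) * ln (x^2 + x + 1/3 - 1 / (45 * a))"
proof -
  have "x^2 + x + (3 * a + 1) / 3 = x^2 + x + 1/3 + a"
    "x^2 + x + (15 * a - 1) / (45 * a) = x^2 + x + 1/3 - 1 / (45 * a)"
    using assms by (simp_all add: diff_divide_distrib add_divide_distrib)
  then show ?thesis
    unfolding psi_L_def by (simp only:)
qed

text \<open>
  With \<open>q = 1/(45 a)\<close> the combined numerator of the left-hand side is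
  \<open>q (z - q) + a (z + a) = (a + q) (z + a - q)\<close>, and the factor \<open>a + q\<close> cancels against the weights.
\<close>
lemma weighted_reciprocals:
  fixes a z :: real
  assumes "a > 0" "z + a > 0" "z - 1 / (45 * a) > 0"
  shows "1 / (90 * a^2 + 2) / (z + a) + 45 * a^2 / (90 * a^2 + 2) / (z - 1 / (45 * a))
           = (z + shift_sum a) / 2 / (z^2 + shift_sum a * z - 1/45)"
proof -
  define q where "q = 1 / (45 * a)"
  have q: "q > 0" "a * q = 1/45"
    using assms by (simp_all add: q_def)
  have w: "1 / (90 * a^2 + 2) = q / (2 * (a + q))" "45 * a^2 / (90 * a^2 + 2) = a / (2 * (a + q))"
    using assms by (simp_all add: q_def divide_simps power2_eq_square)
  have "q / (2 * (a + q)) / (z + a) + a / (2 * (a + q)) / (z - q)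
      = (q * (z - q) + a * (z + a)) / (2 * (a + q) * ((z + a) * (z - q)))"
    using assms q by (simp add: q_def[symmetric] divide_simps) 
  also have "q * (z - q) + a * (z + a) = (a + q) * (z + a - q)"
    by (simp add: algebra_simps)
  also have "(a + q) * (z + a - q) / (2 * (a + q) * ((z + a) * (z - q)))
      = (z + a - q) / 2 / ((z + a) * (z - q))"
  proof -
    have "k * N / (2 * k * D) = N / 2 / D" if "k \<noteq> 0" for k N D :: real
      using that by simp
    moreover have "a + q \<noteq> 0"
      using assms(1) q(1) by simp
    ultimately show ?thesis .
  qed
  also have "(z + a) * (z - q) = z^2 + (a - q) * z - 1/45"
    using q by (simp add: algebra_simps power2_eq_square)
  finally show ?thesis
    unfolding w q_def[symmetric] shift_sum_def by (simp add: algebra_simps)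
qed

lemma has_real_derivative_psi_L:
  assumes "a > 4/15"
  shows "((\<lambda>x. psi_L x a) has_real_derivative psi_slope (shift_sum a) x) (at x)"
proof -
  define z where "z = x^2 + x + 1/3"
  have pos: "a > 0" "z + a > 0" "z - 1 / (45 * a) > 0"
    using assms ln_arg1_pos[OF assms, of x] ln_arg2_pos[OF assms, of x] by (simp_all add: z_def)
  have "((\<lambda>x. w * ln (x^2 + x + 1/3 + a) + v * ln (x^2 + x + 1/3 - 1 / (45 * a)))
     has_real_derivative w * ((2 * x + 1) / (z + a)) + v * ((2 * x + 1) / (z - 1 / (45 * a)))) (at x)"
    for w v
    using pos unfolding z_def by (auto intro!: derivative_eq_intros simp: mult.commute)
  then have "((\<lambda>x. psi_L x a) has_real_derivative
     1 / (90 * a^2 + 2) * ((2 * x + 1) / (z + a))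
       + 45 * a^2 / (90 * a^2 + 2) * ((2 * x + 1) / (z - 1 / (45 * a)))) (at x)"
    unfolding psi_L_eq[OF assms] by blast
  also have "1 / (90 * a^2 + 2) * ((2 * x + 1) / (z + a))
       + 45 * a^2 / (90 * a^2 + 2) * ((2 * x + 1) / (z - 1 / (45 * a)))
     = (2 * x + 1) * (1 / (90 * a^2 + 2) / (z + a) + 45 * a^2 / (90 * a^2 + 2) / (z - 1 / (45 * a)))"
    by (simp add: distrib_left mult_ac)
  also have "\<dots> = (2 * x + 1) * ((z + shift_sum a) / 2 / (z^2 + shift_sum a * z - 1/45))"
    unfolding weighted_reciprocals[OF pos] ..
  also have "\<dots> = psi_slope (shift_sum a) x"
  proof -
    have "(2 * x + 1) * (N / 2 / D) = (x + 1/2) * N / D" for N D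
      by (cases "D = 0") (simp_all add: field_simps)
    then show ?thesis
      unfolding psi_slope_def z_def .
  qed
  finally show ?thesis .
qed

text \<open>
  Writing \<open>p = z + m\<close>, the quotient in the slope is \<open>p / (z p - 1/45) = 1 / (z - 1/(45 p))\<close>, which
  decreases in \<open>p\<close>; the factor \<open>x + 1/2\<close> is positive.
\<close>
lemma psi_slope_strict_antimono:
  assumes a: "a > 4/15" and ab: "a < b" and x: "x > -1/2"
  shows "psi_slope (shift_sum b) x < psi_slope (shift_sum a) x"
proof -
  define z where "z = x^2 + x + 1/3"
  define p where "p = z + shift_sum a"
  define r where "r = z + shift_sum b"
  have b: "b > 4/15" using a ab by simp
  have pr: "p < r"
    using shift_sum_less_iff[of a b] a ab by (simp add: p_def r_def)
  have den: "z * p - 1/45 > 0" "z * r - 1/45 > 0"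
    using slope_denominator_pos[OF a, of x] slope_denominator_pos[OF b, of x]
    unfolding z_def[symmetric] p_def r_def
    by (simp_all add: power2_eq_square algebra_simps)
  have "r / (z * r - 1/45) < p / (z * p - 1/45)"
    using den pr by (simp add: divide_simps) (simp add: algebra_simps)
  then have "(x + 1/2) * (r / (z * r - 1/45)) < (x + 1/2) * (p / (z * p - 1/45))"
    using x by (intro mult_strict_left_mono) auto
  then show ?thesis
    unfolding psi_slope_def z_def[symmetric] p_def r_def
    by (simp add: power2_eq_square distrib_left mult.commute)
qed

text \<open>
  The key cancellation. Over the common denominator the numerator could have degree \<open>9\<close> in \<open>s\<close>,
  but the increment decays at least like \<open>1/s^7\<close>, because the parameters in \<open>psi_L\<close> match the expansion of
  the psi function in powers of \<open>1/(x + 1/2)\<close> up to order four. So only degree \<open>2\<close> survives,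
  and the coefficient of \<open>s\<^sup>2\<close> measures the mismatch at order six.
\<close>
lemma psi_step_deriv_eq:
  assumes "a > 4/15" "s > 0"
  defines "m \<equiv> shift_sum a"
  defines "E \<equiv> \<lambda>x. (x^2 + x + 1/3)^2 + m * (x^2 + x + 1/3) - 1/45"
  shows "psi_slope m s - psi_slope m (s - 1) + 1 / s^2
     = (7/45 * (m - 16/21) * s^2 + (m/3 + 4/45)^2) / (s^2 * E s * E (s - 1))"
proof -
  have pos: "E s \<noteq> 0" "E (s - 1) \<noteq> 0"
    using slope_denominator_pos[OF assms(1), of s] slope_denominator_pos[OF assms(1), of "s - 1"]
    unfolding E_def m_def by linarith+
  have slope: "psi_slope m x = (x + 1/2) * (x^2 + x + 1/3 + m) / E x" for x
    by (simp add: psi_slope_def E_def)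
  have "psi_slope m s - psi_slope m (s - 1) + 1 / s^2
     = (s^2 * ((s + 1/2) * (s^2 + s + 1/3 + m) * E (s - 1)
              - (s - 1/2) * ((s - 1)^2 + (s - 1) + 1/3 + m) * E s) + E s * E (s - 1))
       / (s^2 * E s * E (s - 1))"
    unfolding slope using pos assms(2) by (simp add: divide_simps)
  also have "s^2 * ((s + 1/2) * (s^2 + s + 1/3 + m) * E (s - 1)
              - (s - 1/2) * ((s - 1)^2 + (s - 1) + 1/3 + m) * E s) + E s * E (s - 1)
     = 7/45 * (m - 16/21) * s^2 + (m/3 + 4/45)^2"
    unfolding E_def by (simp add: power2_eq_square field_simps)
  finally show ?thesis .
qed

lemma has_real_derivative_psi_step:
  assumes "a > 4/15" "s > 0"
  shows "(psi_step a has_real_derivative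
     psi_slope (shift_sum a) s - psi_slope (shift_sum a) (s - 1) + 1 / s^2) (at s)"
proof -
  have "((\<lambda>s. psi_L (s - 1) a) has_real_derivative psi_slope (shift_sum a) (s - 1) * 1) (at s)"
    by (rule DERIV_chain2[OF has_real_derivative_psi_L[OF assms(1)]])
       (auto intro!: derivative_eq_intros)
  then show ?thesis
    unfolding psi_step_def using assms(2)
    by (auto intro!: derivative_eq_intros has_real_derivative_psi_L[OF assms(1)]
        simp: power2_eq_square)
qed

lemma psi_gap_step:
  assumes "s > 0"
  shows "psi_gap a s - psi_gap a (s - 1) = psi_step a s"
  using Digamma_plus1[of s] assms by (simp add: psi_gap_def psi_step_def)

section \<open>Behaviour along unit steps to infinity\<close>

lemma psi_L_minus_ln_tendsto:
  assumes "a > 4/15"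
  shows "(\<lambda>n. psi_L (x + real n) a - ln (real n)) \<longlonglongrightarrow> 0"
proof -
  have log: "(\<lambda>n. ln ((x + real n)^2 + (x + real n) + c) - 2 * ln (real n)) \<longlonglongrightarrow> 0" for c
    by real_asymp
  have "(\<lambda>n. 1 / (90 * a^2 + 2) * (ln ((x + real n)^2 + (x + real n) + (3 * a + 1) / 3) - 2 * ln (real n))
      + 45 * a^2 / (90 * a^2 + 2) *
        (ln ((x + real n)^2 + (x + real n) + (15 * a - 1) / (45 * a)) - 2 * ln (real n))) \<longlonglongrightarrow> 0"
    by (rule tendsto_eq_intros log refl)+ simp
  moreover have "1 / (90 * a^2 + 2) * (A - 2 * l) + 45 * a^2 / (90 * a^2 + 2) * (B - 2 * l)
      = 1 / (90 * a^2 + 2) * A + 45 * a^2 / (90 * a^2 + 2) * B - l" for A B l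
  proof -
    have "90 * a^2 + 2 > 0" by (simp add: add_nonneg_pos)
    then show ?thesis by (simp add: divide_simps) (simp add: algebra_simps)
  qed
  ultimately show ?thesis
    unfolding psi_L_def by simp
qed

text \<open>
  The recurrence turns the limit formula for \<open>Digamma z\<close> into asymptotics of \<open>Digamma (z + n)\<close>.
\<close>
lemma Digamma_minus_ln_tendsto:
  fixes z :: real
  assumes "z > 0"
  shows "(\<lambda>n. Digamma (z + real n) - ln (real n)) \<longlonglongrightarrow> 0"
proof -
  have shift: "Digamma (z + real n) = Digamma z + (\<Sum>k<n. inverse (z + real k))" for n
  proof (induction n)
    case (Suc n)
    have "Digamma (z + real n + 1) = Digamma (z + real n) + 1 / (z + real n)"
      using assms by (intro Digamma_plus1) auto
    then show ?case
      using Suc by (simp add: add_ac inverse_eq_divide)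
  qed simp
  have "(\<lambda>n. of_real (ln (real n)) - (\<Sum>k<n. inverse (z + of_nat k))) \<longlonglongrightarrow> Digamma z"
    using assms by (intro Digamma_LIMSEQ) auto
  from tendsto_diff[OF tendsto_const[of "Digamma z"] this] show ?thesis
    unfolding shift by (simp add: algebra_simps)
qed

lemma psi_gap_tendsto:
  assumes "a > 4/15" "x > -1"
  shows "(\<lambda>n. psi_gap a (x + real n)) \<longlonglongrightarrow> 0"
  using tendsto_diff[OF psi_L_minus_ln_tendsto[OF assms(1), of x]
      Digamma_minus_ln_tendsto[of "x + 1"]] assms(2)
  by (simp add: psi_gap_def add_ac)

lemma psi_step_tendsto:
  assumes "a > 4/15" "s > 0"
  shows "(\<lambda>n. psi_step a (s + real n)) \<longlonglongrightarrow> 0"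
proof -
  have "psi_step a (s + real n) = psi_gap a (s + real n) - psi_gap a (s - 1 + real n)" for n
    using psi_gap_step[of "s + real n" a] assms(2) by (simp add: algebra_simps)
  then show ?thesis
    using tendsto_diff[OF psi_gap_tendsto[of a s] psi_gap_tendsto[of a "s - 1"]] assms by simp
qed

section \<open>The gap above and below the critical parameter\<close>

lemma psi_step_deriv_pos:
  assumes "a > 4/15" "a1 \<le> a" "s > 0"
  shows "psi_slope (shift_sum a) s - psi_slope (shift_sum a) (s - 1) + 1 / s^2 > 0"
proof -
  have m: "16 / 21 \<le> shift_sum a"
    using assms a1_le_iff by simp
  have "7/45 * (shift_sum a - 16/21) * s^2 + (shift_sum a / 3 + 4/45)^2 > 0"
    using m by (intro add_nonneg_pos) auto
  then show ?thesis
    unfolding psi_step_deriv_eq[OF assms(1,3)] using assms(3)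
    by (intro divide_pos_pos mult_pos_pos slope_denominator_pos[OF assms(1)]) auto
qed

lemma psi_step_strict_mono:
  assumes "a > 4/15" "a1 \<le> a" "0 < s" "s < t"
  shows "psi_step a s < psi_step a t"
proof (rule DERIV_pos_imp_increasing[OF assms(4)])
  fix r assume "s \<le> r" "r \<le> t"
  then have "r > 0" using assms(3) by simp
  then show "\<exists>y. (psi_step a has_real_derivative y) (at r) \<and> 0 < y"
    using has_real_derivative_psi_step[OF assms(1)] psi_step_deriv_pos[OF assms(1,2)] by blast
qed

lemma psi_step_neg:
  assumes "a > 4/15" "a1 \<le> a" "s > 0"
  shows "psi_step a s < 0"
  using less_limit_of_strictly_increasing[OF psi_step_tendsto[OF assms(1,3)]]
    psi_step_strict_mono[OF assms(1,2)] assms(3) by simp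

lemma psi_gap_Suc:
  assumes "x > -1"
  shows "psi_gap a (x + real (Suc n)) = psi_gap a (x + real n) + psi_step a (x + 1 + real n)"
  using psi_gap_step[of "x + 1 + real n" a] assms by (simp add: algebra_simps)

lemma psi_gap_pos:
  assumes "a > 4/15" "a1 \<le> a" "x > -1"
  shows "psi_gap a x > 0"
proof -
  have "psi_gap a (x + real (Suc n)) < psi_gap a (x + real n)" for n
    using psi_gap_Suc[OF assms(3)] psi_step_neg[OF assms(1,2), of "x + 1 + real n"] assms(3)
    by simp
  from limit_less_of_strictly_decreasing[OF psi_gap_tendsto[OF assms(1,3)] this]
  show ?thesis by simp
qed

text \<open>
  The increments of \<open>F x - F y\<close> along unit steps are differences of \<open>psi_step\<close> at two
  points, so monotonicity of the increment alone gives monotonicity of the gap; the derivative of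
  the psi function does not occur.
\<close>
lemma psi_gap_strict_antimono:
  assumes "a > 4/15" "a1 \<le> a" "x > -1" "x < y"
  shows "psi_gap a y < psi_gap a x"
proof -
  have y: "y > -1" using assms by simp
  define u where "u = (\<lambda>n. psi_gap a (x + real n) - psi_gap a (y + real n))"
  have "u \<longlonglongrightarrow> 0"
    unfolding u_def
    using tendsto_diff[OF psi_gap_tendsto[OF assms(1,3)] psi_gap_tendsto[OF assms(1) y]] by simp
  moreover have "u (Suc n) < u n" for n
    unfolding u_def psi_gap_Suc[OF assms(3)] psi_gap_Suc[OF y]
    using psi_step_strict_mono[OF assms(1,2), of "x + 1 + real n" "y + 1 + real n"] assms by simp
  ultimately have "0 < u 0"
    by (rule limit_less_of_strictly_decreasing)
  then show ?thesis by (simp add: u_def)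
qed

text \<open>
  Below the critical parameter the leading coefficient \<open>m - 16/21\<close> is negative, so that the argument
  for positivity runs with reversed signs from some point on.
\<close>
lemma psi_gap_eventually_neg:
  assumes "a > 4/15" "a < a1"
  shows "\<exists>x > -1. psi_gap a x < 0"
proof -
  define m where "m = shift_sum a"
  have m: "m < 16 / 21"
    using assms a1_le_iff[of a] by (simp add: m_def)
  have "filterlim (\<lambda>s. 7/45 * (m - 16/21) * s^2 + (m/3 + 4/45)^2) at_bot at_top"
    using m by real_asymp
  then have "\<forall>\<^sub>F s in at_top. 7/45 * (m - 16/21) * s^2 + (m/3 + 4/45)^2 < 0"
    by (simp add: filterlim_at_bot_dense)
  then obtain S where S: "\<And>s. s \<ge> S \<Longrightarrow> 7/45 * (m - 16/21) * s^2 + (m/3 + 4/45)^2 < 0"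
    by (auto simp: eventually_at_top_linorder)
  define T where "T = max S 1"
  have deriv_neg: "psi_slope m s - psi_slope m (s - 1) + 1 / s^2 < 0" if "s \<ge> T" for s
  proof -
    have s: "s > 0" "s \<ge> S" using that by (auto simp: T_def)
    show ?thesis
      unfolding m_def psi_step_deriv_eq[OF assms(1) s(1)] using s(1) S[OF s(2)]
      by (intro divide_neg_pos mult_pos_pos slope_denominator_pos[OF assms(1)])
         (auto simp: m_def)
  qed
  have dec: "psi_step a t < psi_step a s" if "T \<le> s" "s < t" for s t
  proof (rule DERIV_neg_imp_decreasing[OF that(2)])
    fix r assume "s \<le> r" "r \<le> t"
    then have "T \<le> r" "r > 0" using that by (auto simp: T_def)
    then show "\<exists>y. (psi_step a has_real_derivative y) (at r) \<and> y < 0"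
      using has_real_derivative_psi_step[OF assms(1)] deriv_neg unfolding m_def by blast
  qed
  have pos: "psi_step a s > 0" if "T \<le> s" for s
  proof -
    have "s > 0" using that by (simp add: T_def)
    from limit_less_of_strictly_decreasing[OF psi_step_tendsto[OF assms(1) this]] dec that
    show ?thesis by simp
  qed
  have T: "T > -1" by (simp add: T_def)
  have "psi_gap a (T + real n) < psi_gap a (T + real (Suc n))" for n
    using psi_gap_Suc[OF T] pos[of "T + 1 + real n"] by simp
  from less_limit_of_strictly_increasing[OF psi_gap_tendsto[OF assms(1) T] this]
  show ?thesis using T by auto
qed

section \<open>Dependence on the parameter\<close>

lemma psi_L_diff_strict_antimono:
  assumes "a > 4/15" "a < b" "-1/2 < x" "x < y"
  shows "psi_L y b - psi_L y a < psi_L x b - psi_L x a"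
proof (rule DERIV_neg_imp_decreasing[OF assms(4)])
  fix r assume "x \<le> r" "r \<le> y"
  then have "r > -1/2" using assms(3) by simp
  moreover have "b > 4/15" using assms by simp
  ultimately show "\<exists>d. ((\<lambda>x. psi_L x b - psi_L x a) has_real_derivative d) (at r) \<and> d < 0"
    using DERIV_diff[OF has_real_derivative_psi_L has_real_derivative_psi_L[OF assms(1)]]
      psi_slope_strict_antimono[OF assms(1,2)]
    by (metis diff_less_0_iff_less)
qed

lemma psi_L_strict_mono:
  assumes "a > 4/15" "a < b" "-1/2 < x"
  shows "psi_L x a < psi_L x b"
proof -
  define u where "u = (\<lambda>n. psi_L (x + real n) b - psi_L (x + real n) a)"
  have "b > 4/15" using assms by simp
  then have "u \<longlonglongrightarrow> 0"
    unfolding u_def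
    using tendsto_diff[OF psi_L_minus_ln_tendsto[of b] psi_L_minus_ln_tendsto[OF assms(1)]]
    by simp
  moreover have "u (Suc n) < u n" for n
    unfolding u_def using assms by (intro psi_L_diff_strict_antimono) auto
  ultimately have "0 < u 0"
    by (rule limit_less_of_strictly_decreasing)
  then show ?thesis by (simp add: u_def)
qed

section \<open>The best constant and the theorem\<close>

lemma psi_gap_0: "psi_gap a 0 = c0 a"
  by (simp add: psi_gap_def c0_def)

lemma c0_le:
  assumes "a > 4/15" "\<And>x. x > 0 \<Longrightarrow> psi_gap a x < c"
  shows "c0 a \<le> c"
proof -
  have "isCont (\<lambda>x. psi_L x a) 0"
    using has_real_derivative_psi_L[OF assms(1)] by (rule DERIV_isCont)
  moreover have "isCont (\<lambda>x::real. Digamma (x + 1)) 0"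
    by (intro continuous_intros) (auto elim!: nonpos_Ints_cases)
  ultimately have "isCont (psi_gap a) 0"
    unfolding psi_gap_def by (rule continuous_diff)
  then have "(psi_gap a \<longlongrightarrow> c0 a) (at_right 0)"
    by (simp add: isCont_def psi_gap_0 filterlim_at_split)
  moreover have "\<forall>\<^sub>F x in at_right 0. psi_gap a x \<le> c"
    using assms(2) by (auto simp: eventually_at_filter less_imp_le)
  ultimately show ?thesis
    by (intro tendsto_upperbound) auto
qed

lemma a1_gt: "a1 > 4/15"
  by (simp add: a1_def add_pos_nonneg field_simps) 

theorem theorem4:
  fixes a :: real
  assumes "a > 4 / 15"
  shows "((\<forall>x > -1. Digamma (x + 1) < psi_L x a) \<longleftrightarrow> a \<ge> a1) \<and>
         (a \<ge> a1 \<longrightarrow>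
           (\<forall>x > 0. psi_L x a - c0 a < Digamma (x + 1) \<and> Digamma (x + 1) < psi_L x a) \<and>
           (\<forall>c. (\<forall>x > 0. psi_L x a - c < Digamma (x + 1)) \<longrightarrow> c0 a \<le> c)) \<and>
         c0 a = 1 / (90 * a^2 + 2) * ln ((3 * a + 1) / 3)
                + 45 * a^2 / (90 * a^2 + 2) * ln ((15 * a - 1) / (45 * a))
                + euler_mascheroni \<and>
         (\<forall>x > 0. strict_antimono_on {a1<..} (\<lambda>b. psi_L x b - c0 b) \<and>
                  strict_mono_on {a1<..} (\<lambda>b. psi_L x b))"
proof (intro conjI impI allI)
  show "(\<forall>x > -1. Digamma (x + 1) < psi_L x a) \<longleftrightarrow> a \<ge> a1"
  proof
    assume upper: "\<forall>x > -1. Digamma (x + 1) < psi_L x a"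
    show "a \<ge> a1"
    proof (rule ccontr)
      assume "\<not> a \<ge> a1"
      then obtain x where "x > -1" "psi_gap a x < 0"
        using psi_gap_eventually_neg[OF assms] by auto
      then show False
        using upper by (force simp: psi_gap_def)
    qed
  next
    assume "a \<ge> a1"
    then show "\<forall>x > -1. Digamma (x + 1) < psi_L x a"
      using psi_gap_pos[OF assms] by (simp add: psi_gap_def)
  qed
next
  fix x :: real
  assume "a \<ge> a1" "x > 0"
  then show "psi_L x a - c0 a < Digamma (x + 1)" "Digamma (x + 1) < psi_L x a"
    using psi_gap_strict_antimono[OF assms, of 0 x] psi_gap_pos[OF assms, of x]
    unfolding psi_gap_0 by (simp_all add: psi_gap_def)
next
  fix c :: real
  assume "\<forall>x > 0. psi_L x a - c < Digamma (x + 1)"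
  then show "c0 a \<le> c"
    by (intro c0_le[OF assms]) (simp add: psi_gap_def algebra_simps)
next
  show "c0 a = 1 / (90 * a^2 + 2) * ln ((3 * a + 1) / 3)
                + 45 * a^2 / (90 * a^2 + 2) * ln ((15 * a - 1) / (45 * a))
                + euler_mascheroni"
    by (simp add: c0_def psi_L_def)
next
  fix x :: real
  assume x: "x > 0"
  show "strict_antimono_on {a1<..} (\<lambda>b. psi_L x b - c0 b)"
  proof (rule monotone_onI)
    fix b d assume "b \<in> {a1<..}" "d \<in> {a1<..}" "b < d"
    then show "psi_L x b - c0 b > psi_L x d - c0 d"
      using psi_L_diff_strict_antimono[of b d 0 x] x a1_gt by (simp add: c0_def)
  qed
  show "strict_mono_on {a1<..} (\<lambda>b. psi_L x b)"
  proof (rule monotone_onI)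
    fix b d assume "b \<in> {a1<..}" "d \<in> {a1<..}" "b < d"
    then show "psi_L x b < psi_L x d"
      using psi_L_strict_mono[of b d x] x a1_gt by simp
  qed
qed

end
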